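(* Let $\gamma$ be a principal continuous TR of a topological space $X$. Then: (1) every principal continuous TR of $X$ is equivalent to $\gamma$; (2) $X$ is a $T_0$-space; (3) for all $x,x_0,x_1,\ldots\in X$, the sequence $\{x_n\}$ $\tau_X$-converges to $x$ iff there exist $a\in\gamma^{-1}(x)$ and $a_n\in\gamma^{-1}(x_n)$ ($n<\omega$) such that $\{a_n\}$ converges to $a$ in $\mathcal{N}$; (4) $\tau_X^s=\tau_\gamma$.
   Context: $\mathcal{N}=\omega^\omega$ is the Baire space. A TR of a space $X$ is a surjection $\gamma:\mathcal{N}\to X$; it is principal (continuous) if it is continuous and every continuous $\nu:\mathcal{N}\to X$ satisfies $\nu=\gamma\circ f$ for some continuous $f:\mathcal{N}\to\mathcal{N}$. TRs $\mu,\nu$ are equivalent if each is of the form (other)$\circ f$ with $f$ continuous on $\mathcal{N}$. $\tau_X$ is the topology of $X$. For a topology $\tau$ on a set $X$, a sequence $\{x_n\}$ $\tau$-converges to $x$ if every $U\in\tau$ with $x\in U$ contains $x_n$ for all sufficiently large $n$; $\tau^s$ is the set of all $A\subseteq X$ such that whenever $\{x_n\}$ $\tau$-converges to some $x\in A$, $x_n\in A$ for all sufficiently large $n$ (the sequentialization). The final topology $\tau_\gamma$ of $\gamma$ consists of all $A\subseteq X$ with $\gamma^{-1}(A)$ open in $\mathcal{N}$. *)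

theory Defs
  imports "HOL-Analysis.Analysis"
begin

text \<open>The Baire space is \<^typ>\<open>nat \<Rightarrow> nat\<close> with its \<^class>\<open>topological_space\<close> instance, the product
  topology over the discrete space \<^typ>\<open>nat\<close>.\<close>

type_synonym baire = "nat \<Rightarrow> nat"

text \<open>A total representation (TR) of a space \<open>X\<close>; surjectivity is onto the carrier
  \<open>topspace X\<close>.\<close>

definition is_TR :: "'a topology \<Rightarrow> (baire \<Rightarrow> 'a) \<Rightarrow> bool" where
  "is_TR X \<gamma> \<longleftrightarrow> range \<gamma> = topspace X"

definition cont_reducible :: "(baire \<Rightarrow> 'a) \<Rightarrow> (baire \<Rightarrow> 'a) \<Rightarrow> bool" where
  "cont_reducible \<mu> \<nu> \<longleftrightarrow> (\<exists>f :: baire \<Rightarrow> baire. continuous_on UNIV f \<and> \<mu> = \<nu> \<circ> f)"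

definition TR_equivalent :: "(baire \<Rightarrow> 'a) \<Rightarrow> (baire \<Rightarrow> 'a) \<Rightarrow> bool" where
  "TR_equivalent \<mu> \<nu> \<longleftrightarrow> cont_reducible \<mu> \<nu> \<and> cont_reducible \<nu> \<mu>"

text \<open>The maps \<open>\<nu>\<close> below need not be surjective.\<close>

definition principal_continuous_TR :: "'a topology \<Rightarrow> (baire \<Rightarrow> 'a) \<Rightarrow> bool" where
  "principal_continuous_TR X \<gamma> \<longleftrightarrow>
     is_TR X \<gamma> \<and> continuous_map euclidean X \<gamma> \<and>
     (\<forall>\<nu> :: baire \<Rightarrow> 'a. continuous_map euclidean X \<nu> \<longrightarrow> cont_reducible \<nu> \<gamma>)"

definition sequentially_open :: "'a topology \<Rightarrow> 'a set \<Rightarrow> bool" where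
  "sequentially_open X A \<longleftrightarrow> A \<subseteq> topspace X \<and>
     (\<forall>s x. range s \<subseteq> topspace X \<and> x \<in> A \<and> limitin X s x sequentially
        \<longrightarrow> (\<forall>\<^sub>F n in sequentially. s n \<in> A))"

definition sequentialization :: "'a topology \<Rightarrow> 'a topology" where
  "sequentialization X = topology (sequentially_open X)"

lemma istopology_sequentially_open: "istopology (sequentially_open X)"
  unfolding istopology_def
proof (intro conjI allI impI)
  fix S T assume "sequentially_open X S" "sequentially_open X T"
  then show "sequentially_open X (S \<inter> T)"
    unfolding sequentially_open_def by (simp add: eventually_conj_iff) blast
next
  fix \<K> assume K: "\<forall>K\<in>\<K>. sequentially_open X K"
  show "sequentially_open X (\<Union>\<K>)"
    unfolding sequentially_open_def
  proof (intro conjI allI impI)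
    show "\<Union>\<K> \<subseteq> topspace X" using K unfolding sequentially_open_def by blast
  next
    fix s x
    assume a: "range s \<subseteq> topspace X \<and> x \<in> \<Union>\<K> \<and> limitin X s x sequentially"
    then obtain B where B: "B \<in> \<K>" "x \<in> B" by blast
    then have "\<forall>\<^sub>F n in sequentially. s n \<in> B"
      using K a unfolding sequentially_open_def by blast
    then show "\<forall>\<^sub>F n in sequentially. s n \<in> \<Union>\<K>"
      by (rule eventually_mono) (use B in blast)
  qed
qed

lemma openin_sequentialization: "openin (sequentialization X) A \<longleftrightarrow> sequentially_open X A"
  unfolding sequentialization_def by (simp add: istopology_sequentially_open)

text \<open>The final topology of \<open>\<gamma>\<close> on the set \<open>S\<close>; \<open>S\<close> is passed explicitly because the carrier of
  a space need not be the whole type.\<close>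

definition final_topology :: "'a set \<Rightarrow> (baire \<Rightarrow> 'a) \<Rightarrow> 'a topology" where
  "final_topology S \<gamma> = topology (\<lambda>A. A \<subseteq> S \<and> open (\<gamma> -` A))"

lemma istopology_final: "istopology (\<lambda>A. A \<subseteq> S \<and> open (\<gamma> -` A))"
  for \<gamma> :: "baire \<Rightarrow> 'a"
  unfolding istopology_def by (auto simp: vimage_Union intro: open_Int)

lemma openin_final_topology: "openin (final_topology S \<gamma>) A \<longleftrightarrow> A \<subseteq> S \<and> open (\<gamma> -` A)"
  unfolding final_topology_def by (simp add: istopology_final)

end

theory Submission
  imports Defs
begin

text \<open>
  Two families of continuous test maps carry the argument. If \<open>x\<close> and \<open>y\<close> were distinct but
  topologically indistinguishable, every map into \<open>{x, y}\<close> would be continuous and hence of the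
  form \<open>\<gamma> \<circ> f\<close> with \<open>f\<close> continuous; since the continuous self-maps of the Baire space can be
  enumerated by the Baire space, diagonalizing gives a contradiction. If \<open>s\<close> converges to \<open>x\<close>, the
  map sending \<open>0\<close> to \<open>x\<close> and a sequence with first non-zero position \<open>n\<close> to \<open>s n\<close> is continuous;
  factoring it through \<open>\<gamma>\<close> lifts the convergent sequence. The sequentialization is then computed
  by moving convergent sequences back and forth along \<open>\<gamma>\<close>.
\<close>

text \<open>A continuous map is determined by its values on a countable dense set, and countably
  many points of the Baire space can be packed into one. The enumeration \<open>e\<close> is a
  set-theoretic inverse of this injective coding.\<close>

lemma continuous_functions_enumerated_by_baire:
  "\<exists>e :: baire \<Rightarrow> baire \<Rightarrow> baire. \<forall>f. continuous_on UNIV f \<longrightarrow> f \<in> range e"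
proof -
  obtain D :: "baire set" where D: "countable D"
    and dense: "\<And>U. open U \<Longrightarrow> U \<noteq> {} \<Longrightarrow> \<exists>d\<in>D. d \<in> U"
    using countable_dense_setE by blast
  define code :: "(baire \<Rightarrow> baire) \<Rightarrow> baire" where
    "code f = (\<lambda>k. f (from_nat_into D (fst (prod_decode k))) (snd (prod_decode k)))" for f
  have "inj_on code {f. continuous_on UNIV f}"
  proof (rule inj_onI)
    fix f g assume f: "f \<in> {f. continuous_on UNIV f}" and g: "g \<in> {f. continuous_on UNIV f}"
      and eq: "code f = code g"
    have agree: "f d = g d" if d: "d \<in> D" for d
    proof
      fix m
      from D d obtain n where "d = from_nat_into D n" by (metis from_nat_into_to_nat_on)
      then show "f d m = g d m"
        using fun_cong[OF eq, of "prod_encode (n, m)"] by (simp add: code_def)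
    qed
    have "f a m = g a m" for a m
    proof -
      \<comment> \<open>Coordinates are discrete, so disagreement at \<open>m\<close> is an open
        condition; were it ever satisfied, it would hold at some point of \<open>D\<close>.\<close>
      have "open {a. f a m \<noteq> g a m}"
        using f g by (simp add: open_Collect_neq continuous_on_product_then_coordinatewise)
      from dense[OF this] agree show ?thesis by auto
    qed
    then show "f = g" by blast
  qed
  then have "f \<in> range (inv_into {f. continuous_on UNIV f} code)" if "continuous_on UNIV f" for f
    using that by (metis inv_into_f_f mem_Collect_eq rangeI)
  then show ?thesis by blast
qed

lemma not_every_two_valued_map_cont_reducible:
  fixes \<gamma> :: "baire \<Rightarrow> 'a"
  assumes "x \<noteq> y"
  obtains \<nu> where "range \<nu> \<subseteq> {x, y}" "\<not> cont_reducible \<nu> \<gamma>"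
proof -
  obtain e :: "baire \<Rightarrow> baire \<Rightarrow> baire" where e: "\<And>f. continuous_on UNIV f \<Longrightarrow> f \<in> range e"
    using continuous_functions_enumerated_by_baire by blast
  \<comment> \<open>Diagonal choice: at the point \<open>a\<close>, \<open>\<nu>\<close> takes a
    value different from that of \<open>\<gamma> \<circ> e a\<close>.\<close>
  define \<nu> where "\<nu> = (\<lambda>a. if \<gamma> (e a a) = x then y else x)"
  have "\<not> cont_reducible \<nu> \<gamma>"
  proof
    assume "cont_reducible \<nu> \<gamma>"
    then obtain a where "\<nu> = \<gamma> \<circ> e a"
      unfolding cont_reducible_def using e by blast
    then have "\<nu> a = \<gamma> (e a a)" by simp
    then show False using assms by (auto simp: \<nu>_def split: if_splits)
  qed
  moreover have "range \<nu> \<subseteq> {x, y}" by (auto simp: \<nu>_def)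
  ultimately show ?thesis by (rule that[rotated])
qed

lemma t0_space_if_all_maps_cont_reducible:
  fixes X :: "'a topology" and \<gamma> :: "baire \<Rightarrow> 'a"
  assumes "\<And>\<nu>. continuous_map euclidean X \<nu> \<Longrightarrow> cont_reducible \<nu> \<gamma>"
  shows "t0_space X"
  unfolding t0_space_def
proof (intro ballI impI, rule ccontr)
  fix x y assume x: "x \<in> topspace X" and y: "y \<in> topspace X" and "x \<noteq> y"
    and *: "\<nexists>U. openin X U \<and> (x \<notin> U) = (y \<in> U)"
  obtain \<nu> where \<nu>: "range \<nu> \<subseteq> {x, y}" "\<not> cont_reducible \<nu> \<gamma>"
    using not_every_two_valued_map_cont_reducible \<open>x \<noteq> y\<close> .
  have two_valued: "\<nu> a = x \<or> \<nu> a = y" for a using \<nu>(1) by blast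
  have "{a. \<nu> a \<in> U} = {} \<or> {a. \<nu> a \<in> U} = UNIV" if "openin X U" for U
  proof -
    have "x \<in> U \<longleftrightarrow> y \<in> U" using * that by blast
    then have "\<nu> a \<in> U \<longleftrightarrow> x \<in> U" for a using two_valued[of a] by auto
    then show ?thesis by simp
  qed
  then have "open {a. \<nu> a \<in> U}" if "openin X U" for U
    using that by (metis open_UNIV open_empty)
  moreover have "\<nu> a \<in> topspace X" for a
    using two_valued[of a] x y by auto
  ultimately have "continuous_map euclidean X \<nu>"
    by (simp add: continuous_map_def)
  with assms \<nu>(2) show False by blast
qed

lemma open_baire_cylinder:
  fixes a :: baire
  shows "open {b. \<forall>k<n. b k = a k}"
  using product_topology_basis'[of "{..<n}" "\<lambda>k. {a k}" "\<lambda>k. k"] by (simp add: open_discrete Ball_def)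

lemma unit_sequences_tendsto_zero:
  "(\<lambda>n k. if k = n then 1 else 0 :: nat) \<longlonglongrightarrow> (\<lambda>_. 0)"
proof -
  have "(\<lambda>n. if k = n then 1 else 0 :: nat) \<longlonglongrightarrow> 0" for k
    by (intro tendsto_eventually eventually_sequentiallyI[of "Suc k"]) auto
  then have "limitin (product_topology (\<lambda>_. euclidean) UNIV)
      (\<lambda>n k. if k = n then 1 else 0 :: nat) (\<lambda>_. 0) sequentially"
    by (simp add: limitin_componentwise)
  then show ?thesis by (simp add: euclidean_product_topology)
qed

text \<open>Away from the zero sequence the map is locally constant; at zero, continuity amounts to
  the convergence of \<open>s\<close> to \<open>x\<close>.\<close>

lemma continuous_map_from_limitin:
  assumes x: "x \<in> topspace X" and s: "range s \<subseteq> topspace X" and lim: "limitin X s x sequentially"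
  shows "continuous_map euclidean X
    (\<lambda>a :: baire. if a = (\<lambda>_. 0) then x else s (LEAST n. a n \<noteq> 0))"
    (is "continuous_map _ _ ?\<nu>")
proof -
  have "open {a. ?\<nu> a \<in> U}" if U: "openin X U" for U
    unfolding open_subopen[of "{a. ?\<nu> a \<in> U}"]
  proof safe
    fix a :: baire assume a: "?\<nu> a \<in> U"
    show "\<exists>T. open T \<and> a \<in> T \<and> T \<subseteq> {a. ?\<nu> a \<in> U}"
    proof (cases "a = (\<lambda>_. 0)")
      case True
      with a lim U obtain N where N: "\<And>n. n \<ge> N \<Longrightarrow> s n \<in> U"
        unfolding limitin_def eventually_sequentially by fastforce
      \<comment> \<open>A point of this cylinder is zero or has its first non-zero position at
        \<open>N\<close> or later.\<close>
      have "?\<nu> b \<in> U" if b: "\<forall>k<N. b k = a k" for b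
      proof (cases "b = (\<lambda>_. 0)")
        case False
        then have "b (LEAST n. b n \<noteq> 0) \<noteq> 0" by (metis (mono_tags, lifting) LeastI ext)
        then have "(LEAST n. b n \<noteq> 0) \<ge> N" using b True by (metis not_le_imp_less)
        with False N show ?thesis by simp
      qed (use a True in simp)
      with open_baire_cylinder[of N a] show ?thesis by blast
    next
      case False
      let ?n = "LEAST n. a n \<noteq> 0"
      have n: "a ?n \<noteq> 0" using False by (metis (mono_tags, lifting) LeastI ext)
      \<comment> \<open>The bound \<open>Suc ?n\<close> makes \<open>b\<close> share the non-zero
        entry at \<open>?n\<close> as well as the zeros before it.\<close>
      have "?\<nu> b \<in> U" if b: "\<forall>k<Suc ?n. b k = a k" for b
      proof -
        have "b ?n \<noteq> 0" using b n by simp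
        moreover have "b k = 0" if "k < ?n" for k
          using b that not_less_Least[OF that] by simp
        ultimately have "(LEAST n. b n \<noteq> 0) = ?n"
          by (intro Least_equality) (auto simp: not_less[symmetric])
        with \<open>b ?n \<noteq> 0\<close> a False show ?thesis by auto
      qed
      with open_baire_cylinder[of "Suc ?n" a] show ?thesis by blast
    qed
  qed
  moreover have "?\<nu> a \<in> topspace X" for a
    using x s by auto
  ultimately show ?thesis by (simp add: continuous_map_def)
qed

lemma limitin_lifts_to_baire:
  fixes X :: "'a topology" and \<gamma> :: "baire \<Rightarrow> 'a"
  assumes reduce: "\<And>\<nu>. continuous_map euclidean X \<nu> \<Longrightarrow> cont_reducible \<nu> \<gamma>"
    and "x \<in> topspace X" "range s \<subseteq> topspace X" "limitin X s x sequentially"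
  shows "\<exists>a b. \<gamma> a = x \<and> (\<forall>n. \<gamma> (b n) = s n) \<and> b \<longlonglongrightarrow> a"
proof -
  define \<nu> where "\<nu> = (\<lambda>a :: baire. if a = (\<lambda>_. 0) then x else s (LEAST n. a n \<noteq> 0))"
  define u :: "nat \<Rightarrow> baire" where "u = (\<lambda>n k. if k = n then 1 else 0)"
  have "cont_reducible \<nu> \<gamma>"
    unfolding \<nu>_def by (intro reduce continuous_map_from_limitin assms)
  then obtain f where f: "continuous_on UNIV f" and \<nu>: "\<nu> = \<gamma> \<circ> f"
    unfolding cont_reducible_def by blast
  \<comment> \<open>The first non-zero position of \<open>u n\<close> is \<open>n\<close>, so
    \<open>\<nu>\<close> maps the convergent sequence \<open>u\<close> onto \<open>s\<close> term by
    term, and \<open>f\<close> turns it into the required lift.\<close>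
  have "(\<lambda>n. f (u n)) \<longlonglongrightarrow> f (\<lambda>_. 0)"
    using continuous_on_tendsto_compose[OF f] unit_sequences_tendsto_zero by (simp add: u_def)
  moreover have "\<gamma> (f (\<lambda>_. 0)) = x"
    using fun_cong[OF \<nu>, of "\<lambda>_. 0"] by (simp add: \<nu>_def)
  moreover have "\<gamma> (f (u n)) = s n" for n
  proof -
    have "u n \<noteq> (\<lambda>_. 0)" by (metis u_def one_neq_zero)
    moreover have "(LEAST k. u n k \<noteq> 0) = n"
      by (intro Least_equality) (auto simp: u_def split: if_splits)
    ultimately have "\<nu> (u n) = s n" by (simp add: \<nu>_def)
    then show ?thesis by (simp add: \<nu>)
  qed
  ultimately show ?thesis by (intro exI[of _ "f (\<lambda>_. 0)"] exI[of _ "\<lambda>n. f (u n)"]) simp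
qed

text \<open>Openness in the Baire space can be tested on sequences, since it is first countable.
  Continuity of \<open>\<gamma>\<close> pushes convergent sequences to \<open>X\<close>, and
  \<open>lift\<close> pulls them back.\<close>

lemma sequentially_open_iff_open_vimage:
  fixes X :: "'a topology" and \<gamma> :: "baire \<Rightarrow> 'a"
  assumes cont: "continuous_map euclidean X \<gamma>"
    and lift: "\<And>x s. x \<in> topspace X \<Longrightarrow> range s \<subseteq> topspace X \<Longrightarrow> limitin X s x sequentially \<Longrightarrow>
      \<exists>a b. \<gamma> a = x \<and> (\<forall>n. \<gamma> (b n) = s n) \<and> b \<longlonglongrightarrow> a"
  shows "sequentially_open X A \<longleftrightarrow> A \<subseteq> topspace X \<and> open (\<gamma> -` A)"
proof
  assume A: "sequentially_open X A"
  have "eventually (\<lambda>b. b \<in> \<gamma> -` A) (nhds a)" if a: "\<gamma> a \<in> A" for a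
    unfolding eventually_nhds_iff_sequentially
  proof (intro allI impI)
    fix b assume "b \<longlonglongrightarrow> a"
    then have "limitin X (\<gamma> \<circ> b) (\<gamma> a) sequentially"
      using continuous_map_limit[OF cont] by simp
    moreover have "range (\<gamma> \<circ> b) \<subseteq> topspace X"
      using cont by (auto simp: continuous_map_def)
    ultimately have "\<forall>\<^sub>F n in sequentially. (\<gamma> \<circ> b) n \<in> A"
      using A a unfolding sequentially_open_def by blast
    then show "\<forall>\<^sub>F n in sequentially. b n \<in> \<gamma> -` A" by simp
  qed
  then have "open (\<gamma> -` A)"
    by (subst open_subopen) (auto simp: eventually_nhds subset_iff Ball_def)
  with A show "A \<subseteq> topspace X \<and> open (\<gamma> -` A)"
    by (simp add: sequentially_open_def)
next
  assume A: "A \<subseteq> topspace X \<and> open (\<gamma> -` A)"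
  have "\<forall>\<^sub>F n in sequentially. s n \<in> A"
    if s: "range s \<subseteq> topspace X" and x: "x \<in> A" and lim: "limitin X s x sequentially" for s x
  proof -
    obtain a b where "\<gamma> a = x" and b: "\<And>n. \<gamma> (b n) = s n" and "b \<longlonglongrightarrow> a"
      using lift[OF _ s lim] A x by blast
    then have "\<forall>\<^sub>F n in sequentially. b n \<in> \<gamma> -` A"
      using A x by (intro topological_tendstoD) auto
    then show ?thesis by (simp add: b)
  qed
  with A show "sequentially_open X A"
    unfolding sequentially_open_def by blast
qed

theorem theorem7p3:
  fixes X :: "'a topology" and \<gamma> :: "baire \<Rightarrow> 'a"
  assumes "principal_continuous_TR X \<gamma>"
  shows "(\<forall>\<mu>. principal_continuous_TR X \<mu> \<longrightarrow> TR_equivalent \<mu> \<gamma>)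
    \<and> t0_space X
    \<and> (\<forall>x s. x \<in> topspace X \<and> range s \<subseteq> topspace X \<longrightarrow>
         (limitin X s x sequentially \<longleftrightarrow>
           (\<exists>a b. \<gamma> a = x \<and> (\<forall>n. \<gamma> (b n) = s n) \<and> b \<longlonglongrightarrow> a)))
    \<and> sequentialization X = final_topology (topspace X) \<gamma>"
proof -
  have cont: "continuous_map euclidean X \<gamma>"
    and reduce: "\<And>\<nu>. continuous_map euclidean X \<nu> \<Longrightarrow> cont_reducible \<nu> \<gamma>"
    using assms by (auto simp: principal_continuous_TR_def)
  note lift = limitin_lifts_to_baire[OF reduce]
  have "TR_equivalent \<mu> \<gamma>" if "principal_continuous_TR X \<mu>" for \<mu>
    \<comment> \<open>Both maps are continuous, so the universal property of each factors the other
      through it.\<close>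
    using that cont reduce by (simp add: TR_equivalent_def principal_continuous_TR_def)
  moreover have "t0_space X"
    using reduce by (rule t0_space_if_all_maps_cont_reducible)
  moreover have "limitin X s x sequentially \<longleftrightarrow>
      (\<exists>a b. \<gamma> a = x \<and> (\<forall>n. \<gamma> (b n) = s n) \<and> b \<longlonglongrightarrow> a)"
    if "x \<in> topspace X" "range s \<subseteq> topspace X" for x s
  proof
    assume "\<exists>a b. \<gamma> a = x \<and> (\<forall>n. \<gamma> (b n) = s n) \<and> b \<longlonglongrightarrow> a"
    then obtain a b where "\<gamma> a = x" "\<And>n. \<gamma> (b n) = s n" "b \<longlonglongrightarrow> a" by blast
    moreover from this have "s = \<gamma> \<circ> b" by (simp add: fun_eq_iff)
    ultimately show "limitin X s x sequentially"
      using continuous_map_limit[OF cont, of b a] by simp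
  qed (use lift that in blast)
  moreover have "sequentialization X = final_topology (topspace X) \<gamma>"
    unfolding topology_eq openin_sequentialization openin_final_topology
    by (intro allI sequentially_open_iff_open_vimage[OF cont lift])
  ultimately show ?thesis by blast
qed

end
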